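(* Let $A\in\mathbf{rGr}^{\bullet}$. If $A$ is perfect and $\mathsf{wStab}(A)=0$ (i.e. $\mathsf{wStab}(A)=\{0\}$), then the action of $\mathsf{Pentact}(A)$ on $A$, given by $\mathbf{b}\cdot a=b\cdot a$, $a^{\mathbf{b}}=a^{b}$, $\mathbf{b}^{a}=b^{a}$ for $\mathbf{b}\in\mathsf{Pentact}(A)$, $a\in A$, is a derived action in $\mathbf{rGr}^{\bullet}$.
   Context: **Reduced groups with action.** A group with action is a group $G$ (written additively, not assumed commutative) with a map $G\times G\to G$, $(g,h)\mapsto g^{h}$, such that $(g+g')^{h}=g^{h}+g'^{h}$, $g^{h+h'}=(g^{h})^{h'}$, $g^{0}=g$ for all $g,g',h,h'\in G$. Morphisms are group homomorphisms $\alpha$ with $\alpha(g^{h})=\alpha(g)^{\alpha(h)}$. The category $\mathbf{rGr}^{\bullet}$ of reduced groups with action is the full subcategory of those $G$ such that for all $x,y,z\in G$: $x^{y}+z=z+x^{y}$ whenever $y\neq 0$, and $x^{(y^{z})}=x^{y}$. **Derived actions.** Let $A,B\in\mathbf{rGr}^{\bullet}$. A split extension of $B$ by $A$ is a sequence $0\to A\xrightarrow{i}E\xrightarrow{p}B\to0$ in $\mathbf{rGr}^{\bullet}$ with $p$ surjective and $i$ the kernel of $p$, together with a morphism $j\colon B\to E$ in $\mathbf{rGr}^{\bullet}$ with $pj=1_B$; $i(a)$ is identified with $a$. It induces a triple of functions $B\times A\to A$: $b\cdot a=j(b)+a-j(b)$, $\ b^{a}=j(b)^{a}-j(b)$, $\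 a^{b}=a^{j(b)}$. A triple of functions $B\times A\to A$ (denoted $b\cdot a$, $b^{a}$, $a^{b}$) is a derived action of $B$ on $A$ in $\mathbf{rGr}^{\bullet}$ if it arises in this way from a split extension of $B$ by $A$. **Perfect.** $A\in\mathbf{rGr}^{\bullet}$ is perfect if $A^{A}=A$, where $A^{A}$ is the subobject of $A$ (subgroup closed under the action operation) generated by the elements $a^{a'}$, $a,a'\in A$. **Pentactions.** Let $A\in\mathbf{rGr}^{\bullet}$. Consider a quintuple $\mathbf{b}$ of functions $A\to A$ whose values at $a\in A$ are denoted respectively $b\cdot a,\ a\cdot b,\ a^{b},\ {}^{b}a,\ b^{a}$ (here $b$ is only a symbol indexing the quintuple). For $x,a\in A$ put ${}^{x}a:=a^{-x}$. The quintuple $\mathbf{b}$ is a pentaction of $A$ if for all $a,a'\in A$: 1. $b\cdot(a+a')=b\cdot a+b\cdot a'$; 1°. $(a+a')\cdot b=a\cdot b+a'\cdot b$; 2. $(a+a')^{b}=a^{b}+a'^{b}$; 2°. ${}^{b}(a+a')={}^{b}a+{}^{b}a'$; 3. $(b\cdot a)^{a'}=a^{a'}$ if $a'\neq0$; 3°. $(a\cdot b)^{a'}=a^{a'}$ if $a'\ne 0$; 4. $b^{(a+a')}=(b^{a})^{a'}+b^{a'}$; 5. $(a^{b\cdot a'})^{b}=(a^{b})^{a'}$; 5°. ${}^{b}({}^{a'\cdot b}a)={}^{a'}({}^{b}a)$; 6. $b\cdot a^{a'}=a^{a'}$ if $a'\neq 0$; 6°. $a^{a'}\cdot b=a^{a'}$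 if $a'\ne0$; 7. $b^{(a^{a'})}=b^{a}$; 8. $a^{b}+a'=a'+a^{b}$ for all $a,a'$, provided $x^{b}\neq x$ for at least one $x\in A$; 8°. ${}^{b}a+a'=a'+{}^{b}a$ for all $a,a'$, provided ${}^{b}x\neq x$ for at least one $x\in A$; 9. $a^{(a'^{b})}=a^{a'}$; 9°. $a^{({}^{b}a')}=a^{a'}$; 10. $a^{(b^{a'})}=a$ if $a'\neq0$; 11. $(b\cdot a)\cdot b=b\cdot(a\cdot b)=a$; 12. ${}^{b}(a^{b})=({}^{b}a)^{b}=a$. $\mathsf{Pentact}(A)$ is the set of all pentactions of $A$. **Operations.** $\mathsf{Pentact}(A)$ is considered with the following addition and action operation. For pentactions $\mathbf{b},\mathbf{b}'$ of $A$ the quintuple $\mathbf{b}+\mathbf{b}'$ is defined by $(b+b')\cdot a=b\cdot(b'\cdot a)$, $a\cdot(b+b')=(a\cdot b)\cdot b'$, $a^{(b+b')}=(a^{b})^{b'}$, ${}^{(b+b')}a={}^{b}({}^{b'}a)$, $(b+b')^{a}=b^{a}+b\cdot(b'^{a})$; and the quintuple $\mathbf{b}^{\mathbf{b}'}$ is defined by $(b^{b'})\cdot a=a$, $a\cdot(b^{b'})=a$, $a^{(b^{b'})}=a^{b}$, ${}^{(b^{b'})}a={}^{b}a$, $(b^{b'})^{a}=(b^{(b'\cdot a)})^{b'}$. The zero pentaction $\mathbf{0}$ is given by $0\cdot a=a\cdot 0=a^{0}={}^{0}a=a$, $0^{a}=0$. **Weak stabilizer.** $\mathsf{wStab}(A)$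 is the set of all elements of $A$ of the forms $b^{(b'^{a})}$, $\ b^{(a^{b'})}-b^{a}$, $\ a^{b+b'}-a^{b'+b}$, where $a\in A$ and $\mathbf{b},\mathbf{b}'\in\mathsf{Pentact}(A)$. *)

theory Defs
  imports "HOL-Algebra.Coset" "HOL-Library.FuncSet"
begin

(* Groups are additive (but not assumed commutative) in the mathematics.  Following HOL-Algebra,
   x + y, 0 and -x are written  x \<otimes> y,  \<one>  and  inv x;  the value x^y of the action of y on x is
   written  x \<up> y. *)

section \<open>Reduced groups with action\<close>

record 'a gact = "'a monoid" +
  actn :: "'a \<Rightarrow> 'a \<Rightarrow> 'a"  (infixl "\<up>\<index>" 75)

locale group_with_action = group G for G (structure) +
  assumes act_closed: "\<lbrakk>g \<in> carrier G; h \<in> carrier G\<rbrakk> \<Longrightarrow> g \<up> h \<in> carrier G"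
    and act_mult: "\<lbrakk>g \<in> carrier G; g' \<in> carrier G; h \<in> carrier G\<rbrakk>
        \<Longrightarrow> (g \<otimes> g') \<up> h = (g \<up> h) \<otimes> (g' \<up> h)"
    and act_act: "\<lbrakk>g \<in> carrier G; h \<in> carrier G; h' \<in> carrier G\<rbrakk>
        \<Longrightarrow> g \<up> (h \<otimes> h') = (g \<up> h) \<up> h'"
    and act_one: "g \<in> carrier G \<Longrightarrow> g \<up> \<one> = g"

locale reduced_gwa = group_with_action +
  assumes act_central: "\<lbrakk>x \<in> carrier G; y \<in> carrier G; z \<in> carrier G; y \<noteq> \<one>\<rbrakk>
        \<Longrightarrow> (x \<up> y) \<otimes> z = z \<otimes> (x \<up> y)"
    and act_exp: "\<lbrakk>x \<in> carrier G; y \<in> carrier G; z \<in> carrier G\<rbrakk>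
        \<Longrightarrow> x \<up> (y \<up> z) = x \<up> y"

definition gwa_hom :: "('a, 'm) gact_scheme \<Rightarrow> ('b, 'n) gact_scheme \<Rightarrow> ('a \<Rightarrow> 'b) set" where
  "gwa_hom G H = {f \<in> hom G H. \<forall>x \<in> carrier G. \<forall>y \<in> carrier G.
      f (x \<up>\<^bsub>G\<^esub> y) = f x \<up>\<^bsub>H\<^esub> f y}"

definition subobject :: "'a set \<Rightarrow> ('a, 'm) gact_scheme \<Rightarrow> bool" where
  "subobject H G \<longleftrightarrow> subgroup H G \<and> (\<forall>x \<in> H. \<forall>y \<in> H. x \<up>\<^bsub>G\<^esub> y \<in> H)"

definition subobject_generated :: "('a, 'm) gact_scheme \<Rightarrow> 'a set \<Rightarrow> 'a set" where
  "subobject_generated G S = \<Inter>{H. subobject H G \<and> S \<subseteq> H}"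

definition perfect :: "('a, 'm) gact_scheme \<Rightarrow> bool" where
  "perfect A \<longleftrightarrow>
     subobject_generated A {a \<up>\<^bsub>A\<^esub> a' | a a'. a \<in> carrier A \<and> a' \<in> carrier A} = carrier A"


section \<open>Derived actions\<close>

definition split_extension ::
  "('a, 'm) gact_scheme \<Rightarrow> ('e, 'k) gact_scheme \<Rightarrow> ('b, 'n) gact_scheme \<Rightarrow>
     ('a \<Rightarrow> 'e) \<Rightarrow> ('e \<Rightarrow> 'b) \<Rightarrow> ('b \<Rightarrow> 'e) \<Rightarrow> bool" where
  "split_extension A E B i p j \<longleftrightarrow>
     reduced_gwa A \<and> reduced_gwa E \<and> reduced_gwa B \<and>
     i \<in> gwa_hom A E \<and> p \<in> gwa_hom E B \<and> j \<in> gwa_hom B E \<and>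
     inj_on i (carrier A) \<and> i ` carrier A = kernel E B p \<and> p ` carrier E = carrier B \<and>
     (\<forall>b \<in> carrier B. p (j b) = b)"

(* dot b a, bexp b a, aexp b a stand for  b . a,  b^a,  a^b. *)
definition induced_action ::
  "('a, 'm) gact_scheme \<Rightarrow> ('e, 'k) gact_scheme \<Rightarrow> ('b, 'n) gact_scheme \<Rightarrow>
     ('a \<Rightarrow> 'e) \<Rightarrow> ('b \<Rightarrow> 'e) \<Rightarrow>
     ('b \<Rightarrow> 'a \<Rightarrow> 'a) \<Rightarrow> ('b \<Rightarrow> 'a \<Rightarrow> 'a) \<Rightarrow> ('b \<Rightarrow> 'a \<Rightarrow> 'a) \<Rightarrow> bool" where
  "induced_action A E B i j dot bexp aexp \<longleftrightarrow>
     (\<forall>b \<in> carrier B. \<forall>a \<in> carrier A.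
        dot b a \<in> carrier A \<and> bexp b a \<in> carrier A \<and> aexp b a \<in> carrier A \<and>
        i (dot b a) = j b \<otimes>\<^bsub>E\<^esub> i a \<otimes>\<^bsub>E\<^esub> inv\<^bsub>E\<^esub> (j b) \<and>
        i (bexp b a) = (j b \<up>\<^bsub>E\<^esub> i a) \<otimes>\<^bsub>E\<^esub> inv\<^bsub>E\<^esub> (j b) \<and>
        i (aexp b a) = i a \<up>\<^bsub>E\<^esub> j b)"

(* A definition cannot quantify over the type of the elements of E, so that type is fixed to be
   'a \<times> 'b.  This is no restriction, since e \<mapsto> (e - j (p e), p e) embeds every split extension of
   B by A into A \<times> B:  see lemma derived_actionI below. *)
definition derived_action ::
  "('a, 'm) gact_scheme \<Rightarrow> ('b, 'n) gact_scheme \<Rightarrow>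
     ('b \<Rightarrow> 'a \<Rightarrow> 'a) \<Rightarrow> ('b \<Rightarrow> 'a \<Rightarrow> 'a) \<Rightarrow> ('b \<Rightarrow> 'a \<Rightarrow> 'a) \<Rightarrow> bool" where
  "derived_action A B dot bexp aexp \<longleftrightarrow>
     (\<exists>(E :: ('a \<times> 'b) gact) i p j.
        split_extension A E B i p j \<and> induced_action A E B i j dot bexp aexp)"

lemma transport_structure:
  fixes E :: "('e, 'k) gact_scheme" and f :: "'e \<Rightarrow> 'f"
  assumes E: "reduced_gwa E" and inj: "inj_on f (carrier E)"
  obtains E' :: "'f gact" and g where
    "reduced_gwa E'" "f \<in> gwa_hom E E'" "g \<in> gwa_hom E' E"
    "f ` carrier E = carrier E'" "\<And>x. x \<in> carrier E \<Longrightarrow> g (f x) = x"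
proof -
  interpret E: reduced_gwa E by (fact E)
  define g where "g = inv_into (carrier E) f"
  have gf [simp]: "g (f x) = x" if "x \<in> carrier E" for x
    using inj that by (simp add: g_def)
  define E' where "E' = \<lparr>carrier = f ` carrier E, mult = (\<lambda>u v. f (g u \<otimes>\<^bsub>E\<^esub> g v)), one = f \<one>\<^bsub>E\<^esub>,
     actn = (\<lambda>u v. f (g u \<up>\<^bsub>E\<^esub> g v))\<rparr>"
  have [simp]: "carrier E' = f ` carrier E" "\<one>\<^bsub>E'\<^esub> = f \<one>\<^bsub>E\<^esub>"
    "u \<otimes>\<^bsub>E'\<^esub> v = f (g u \<otimes>\<^bsub>E\<^esub> g v)" "u \<up>\<^bsub>E'\<^esub> v = f (g u \<up>\<^bsub>E\<^esub> g v)" for u v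
    by (simp_all add: E'_def)
  note [simp] = E.act_closed E.m_assoc
  have grp: "group E'"
  proof (rule groupI)
    fix x assume "x \<in> carrier E'"
    then obtain u where u: "u \<in> carrier E" "x = f u" by auto
    then have "f (inv\<^bsub>E\<^esub> u) \<in> carrier E'" "f (inv\<^bsub>E\<^esub> u) \<otimes>\<^bsub>E'\<^esub> x = \<one>\<^bsub>E'\<^esub>" by auto
    then show "\<exists>y\<in>carrier E'. y \<otimes>\<^bsub>E'\<^esub> x = \<one>\<^bsub>E'\<^esub>" by blast
  qed auto
  have gwa: "group_with_action E'"
    by (intro group_with_action.intro grp group_with_action_axioms.intro)
       (auto simp: E.act_mult E.act_act E.act_one)
  have "reduced_gwa E'"
    by (intro reduced_gwa.intro gwa reduced_gwa_axioms.intro)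
       (auto simp: E.act_exp intro!: arg_cong[where f = f] E.act_central)
  moreover have "f \<in> gwa_hom E E'" "g \<in> gwa_hom E' E"
    by (auto simp: gwa_hom_def hom_def)
  ultimately show ?thesis using that[of E' g] by simp
qed

lemma gwa_hom_comp:
  "\<lbrakk>f \<in> gwa_hom G H; g \<in> gwa_hom H K\<rbrakk> \<Longrightarrow> (\<lambda>x. g (f x)) \<in> gwa_hom G K"
  by (auto simp: gwa_hom_def hom_def Pi_iff)

lemma derived_actionI:
  fixes E :: "('e, 'k) gact_scheme"
    and A :: "('a, 'm) gact_scheme" and B :: "('b, 'n) gact_scheme"
  assumes se: "split_extension A E B i p j"
    and ind: "induced_action A E B i j dot bexp aexp"
  shows "derived_action A B dot bexp aexp"
proof -
  from se have homs: "i \<in> gwa_hom A E" "p \<in> gwa_hom E B" "j \<in> gwa_hom B E"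
    and EB: "reduced_gwa E" "reduced_gwa B"
    and ki: "i ` carrier A = kernel E B p"
    by (auto simp: split_extension_def)
  interpret E: reduced_gwa E by fact
  interpret B: reduced_gwa B by fact
  interpret p: group_hom E B p
    using homs by unfold_locales (auto simp: gwa_hom_def)
  have jc: "j b \<in> carrier E" if "b \<in> carrier B" for b
    using homs that by (auto simp: gwa_hom_def hom_def)
  have ic: "i a \<in> carrier E" if "a \<in> carrier A" for a
    using homs that by (auto simp: gwa_hom_def hom_def)
  define f where "f e = (inv_into (carrier A) i (e \<otimes>\<^bsub>E\<^esub> inv\<^bsub>E\<^esub> j (p e)), p e)" for e
  have ker: "e \<otimes>\<^bsub>E\<^esub> inv\<^bsub>E\<^esub> j (p e) \<in> i ` carrier A" if "e \<in> carrier E" for e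
    using that se by (auto simp: ki kernel_def jc split_extension_def)
  have "inj_on f (carrier E)"
  proof (rule inj_onI)
    fix e e' assume e: "e \<in> carrier E" "e' \<in> carrier E" "f e = f e'"
    then have pe: "p e = p e'" by (simp add: f_def)
    have "e \<otimes>\<^bsub>E\<^esub> inv\<^bsub>E\<^esub> j (p e) = e' \<otimes>\<^bsub>E\<^esub> inv\<^bsub>E\<^esub> j (p e')"
      using e ker[of e] ker[of e'] by (auto simp: f_def dest: inv_into_injective)
    with pe e show "e = e'" by (simp add: jc)
  qed
  from transport_structure[OF EB(1) this] obtain E' :: "('a \<times> 'b) gact" and g where E':
    "reduced_gwa E'" "f \<in> gwa_hom E E'" "g \<in> gwa_hom E' E"
    "f ` carrier E = carrier E'" and gf: "\<And>x. x \<in> carrier E \<Longrightarrow> g (f x) = x" by blast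
  interpret E': reduced_gwa E' by fact
  interpret f: group_hom E E' f
    using E' by unfold_locales (auto simp: gwa_hom_def)
  have f_act: "f (x \<up>\<^bsub>E\<^esub> y) = f x \<up>\<^bsub>E'\<^esub> f y" if "x \<in> carrier E" "y \<in> carrier E" for x y
    using E'(2) that by (auto simp: gwa_hom_def)
  have "split_extension A E' B (\<lambda>a. f (i a)) (\<lambda>e. p (g e)) (\<lambda>b. f (j b))"
    unfolding split_extension_def
  proof (intro conjI)
    have k: "kernel E' B (\<lambda>e. p (g e)) = f ` kernel E B p"
      using gf by (auto simp: kernel_def E'(4)[symmetric])
    show "(\<lambda>a. f (i a)) ` carrier A = kernel E' B (\<lambda>e. p (g e))"
      unfolding k ki[symmetric] by auto
    show "inj_on (\<lambda>a. f (i a)) (carrier A)"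
      using se gf ic unfolding split_extension_def inj_on_def by metis
    show "(\<lambda>e. p (g e)) ` carrier E' = carrier B"
    proof -
      have "(\<lambda>e. p (g e)) ` carrier E' = p ` carrier E"
        using gf by (auto simp: E'(4)[symmetric] image_image)
      then show ?thesis using se by (simp add: split_extension_def)
    qed
  qed (use se E' homs gf jc in \<open>auto simp: split_extension_def intro: gwa_hom_comp\<close>)
  moreover have "induced_action A E' B (\<lambda>a. f (i a)) (\<lambda>b. f (j b)) dot bexp aexp"
    using ind by (auto simp: induced_action_def jc ic f_act E.act_closed)
  ultimately show ?thesis unfolding derived_action_def by blast
qed


section \<open>Pentactions\<close>

(* For a quintuple b:   ldot b a = b . a,   rdot b a = a . b,   rexp b a = a^b,
   lexp b a = {}^b a  (b as a left superscript),   bexp b a = b^a. *)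
record 'a quintuple =
  ldot :: "'a \<Rightarrow> 'a"
  rdot :: "'a \<Rightarrow> 'a"
  rexp :: "'a \<Rightarrow> 'a"
  lexp :: "'a \<Rightarrow> 'a"
  bexp :: "'a \<Rightarrow> 'a"

(* The components are extensional functions, so that equality of records is equality of quintuples
   of functions A \<rightarrow> A.  For an element x of A, {}^x a = a^(-x) is  a \<up> inv x. *)
locale pentaction =
  fixes A :: "('a, 'm) gact_scheme" (structure) and b :: "'a quintuple"
  assumes ldot_funcset: "ldot b \<in> carrier A \<rightarrow>\<^sub>E carrier A"
    and rdot_funcset: "rdot b \<in> carrier A \<rightarrow>\<^sub>E carrier A"
    and rexp_funcset: "rexp b \<in> carrier A \<rightarrow>\<^sub>E carrier A"
    and lexp_funcset: "lexp b \<in> carrier A \<rightarrow>\<^sub>E carrier A"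
    and bexp_funcset: "bexp b \<in> carrier A \<rightarrow>\<^sub>E carrier A"
    and p1: "\<lbrakk>a \<in> carrier A; a' \<in> carrier A\<rbrakk> \<Longrightarrow> ldot b (a \<otimes> a') = ldot b a \<otimes> ldot b a'"
    and p1': "\<lbrakk>a \<in> carrier A; a' \<in> carrier A\<rbrakk> \<Longrightarrow> rdot b (a \<otimes> a') = rdot b a \<otimes> rdot b a'"
    and p2: "\<lbrakk>a \<in> carrier A; a' \<in> carrier A\<rbrakk> \<Longrightarrow> rexp b (a \<otimes> a') = rexp b a \<otimes> rexp b a'"
    and p2': "\<lbrakk>a \<in> carrier A; a' \<in> carrier A\<rbrakk> \<Longrightarrow> lexp b (a \<otimes> a') = lexp b a \<otimes> lexp b a'"
    and p3: "\<lbrakk>a \<in> carrier A; a' \<in> carrier A; a' \<noteq> \<one>\<rbrakk> \<Longrightarrow> ldot b a \<up> a' = a \<up> a'"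
    and p3': "\<lbrakk>a \<in> carrier A; a' \<in> carrier A; a' \<noteq> \<one>\<rbrakk> \<Longrightarrow> rdot b a \<up> a' = a \<up> a'"
    and p4: "\<lbrakk>a \<in> carrier A; a' \<in> carrier A\<rbrakk>
        \<Longrightarrow> bexp b (a \<otimes> a') = (bexp b a \<up> a') \<otimes> bexp b a'"
    and p5: "\<lbrakk>a \<in> carrier A; a' \<in> carrier A\<rbrakk>
        \<Longrightarrow> rexp b (a \<up> ldot b a') = rexp b a \<up> a'"
    and p5': "\<lbrakk>a \<in> carrier A; a' \<in> carrier A\<rbrakk>
        \<Longrightarrow> lexp b (a \<up> inv (rdot b a')) = lexp b a \<up> inv a'"
    and p6: "\<lbrakk>a \<in> carrier A; a' \<in> carrier A; a' \<noteq> \<one>\<rbrakk> \<Longrightarrow> ldot b (a \<up> a') = a \<up> a'"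
    and p6': "\<lbrakk>a \<in> carrier A; a' \<in> carrier A; a' \<noteq> \<one>\<rbrakk> \<Longrightarrow> rdot b (a \<up> a') = a \<up> a'"
    and p7: "\<lbrakk>a \<in> carrier A; a' \<in> carrier A\<rbrakk> \<Longrightarrow> bexp b (a \<up> a') = bexp b a"
    and p8: "\<lbrakk>\<exists>x \<in> carrier A. rexp b x \<noteq> x; a \<in> carrier A; a' \<in> carrier A\<rbrakk>
        \<Longrightarrow> rexp b a \<otimes> a' = a' \<otimes> rexp b a"
    and p8': "\<lbrakk>\<exists>x \<in> carrier A. lexp b x \<noteq> x; a \<in> carrier A; a' \<in> carrier A\<rbrakk>
        \<Longrightarrow> lexp b a \<otimes> a' = a' \<otimes> lexp b a"
    and p9: "\<lbrakk>a \<in> carrier A; a' \<in> carrier A\<rbrakk> \<Longrightarrow> a \<up> rexp b a' = a \<up> a'"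
    and p9': "\<lbrakk>a \<in> carrier A; a' \<in> carrier A\<rbrakk> \<Longrightarrow> a \<up> lexp b a' = a \<up> a'"
    and p10: "\<lbrakk>a \<in> carrier A; a' \<in> carrier A; a' \<noteq> \<one>\<rbrakk> \<Longrightarrow> a \<up> bexp b a' = a"
    and p11: "a \<in> carrier A \<Longrightarrow> rdot b (ldot b a) = a"
    and p11': "a \<in> carrier A \<Longrightarrow> ldot b (rdot b a) = a"
    and p12: "a \<in> carrier A \<Longrightarrow> lexp b (rexp b a) = a"
    and p12': "a \<in> carrier A \<Longrightarrow> rexp b (lexp b a) = a"

definition pent_add :: "('a, 'm) gact_scheme \<Rightarrow> 'a quintuple \<Rightarrow> 'a quintuple \<Rightarrow> 'a quintuple" where
  "pent_add A b b' = \<lparr>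
     ldot = (\<lambda>a \<in> carrier A. ldot b (ldot b' a)),
     rdot = (\<lambda>a \<in> carrier A. rdot b' (rdot b a)),
     rexp = (\<lambda>a \<in> carrier A. rexp b' (rexp b a)),
     lexp = (\<lambda>a \<in> carrier A. lexp b (lexp b' a)),
     bexp = (\<lambda>a \<in> carrier A. bexp b a \<otimes>\<^bsub>A\<^esub> ldot b (bexp b' a))\<rparr>"

definition pent_zero :: "('a, 'm) gact_scheme \<Rightarrow> 'a quintuple" where
  "pent_zero A = \<lparr>
     ldot = (\<lambda>a \<in> carrier A. a),
     rdot = (\<lambda>a \<in> carrier A. a),
     rexp = (\<lambda>a \<in> carrier A. a),
     lexp = (\<lambda>a \<in> carrier A. a),
     bexp = (\<lambda>a \<in> carrier A. \<one>\<^bsub>A\<^esub>)\<rparr>"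

definition pent_act :: "('a, 'm) gact_scheme \<Rightarrow> 'a quintuple \<Rightarrow> 'a quintuple \<Rightarrow> 'a quintuple" where
  "pent_act A b b' = \<lparr>
     ldot = (\<lambda>a \<in> carrier A. a),
     rdot = (\<lambda>a \<in> carrier A. a),
     rexp = (\<lambda>a \<in> carrier A. rexp b a),
     lexp = (\<lambda>a \<in> carrier A. lexp b a),
     bexp = (\<lambda>a \<in> carrier A. rexp b' (bexp b (ldot b' a)))\<rparr>"

definition Pentact :: "('a, 'm) gact_scheme \<Rightarrow> 'a quintuple gact" where
  "Pentact A = \<lparr>carrier = {b. pentaction A b}, mult = pent_add A, one = pent_zero A,
     actn = pent_act A\<rparr>"

definition wStab :: "('a, 'm) gact_scheme \<Rightarrow> 'a set" where
  "wStab A =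
     {bexp b (bexp b' a) | a b b'.
        a \<in> carrier A \<and> b \<in> carrier (Pentact A) \<and> b' \<in> carrier (Pentact A)} \<union>
     {bexp b (rexp b' a) \<otimes>\<^bsub>A\<^esub> inv\<^bsub>A\<^esub> (bexp b a) | a b b'.
        a \<in> carrier A \<and> b \<in> carrier (Pentact A) \<and> b' \<in> carrier (Pentact A)} \<union>
     {rexp (b \<otimes>\<^bsub>Pentact A\<^esub> b') a \<otimes>\<^bsub>A\<^esub> inv\<^bsub>A\<^esub> (rexp (b' \<otimes>\<^bsub>Pentact A\<^esub> b) a) | a b b'.
        a \<in> carrier A \<and> b \<in> carrier (Pentact A) \<and> b' \<in> carrier (Pentact A)}"

end

theory Submission
  imports Defs
begin

text \<open>
  If \<open>y \<noteq> 0\<close>, then \<open>x \<mapsto> x\<^sup>y\<close> is a bijection with inverse \<open>x \<mapsto> x\<^bsup>-y\<^esup>\<close>, so every element of a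
  nonzero reduced group with action is of the form \<open>x\<^sup>y\<close>. Hence such a group \<open>A\<close> is commutative,
  and condition 6 forces \<open>b \<cdot> a = a\<close> for each pentaction \<open>b\<close>. A pentaction is therefore an
  automorphism \<open>a \<mapsto> a\<^sup>b\<close> together with a crossed homomorphism \<open>a \<mapsto> b\<^sup>a\<close>; the sum composes the
  former and adds the latter. The weak stabilizer condition makes \<open>Pentact(A)\<close> commutative and
  provides the identities for which \<open>(a, b)\<^bsup>(a', b')\<^esup> = ((a\<^bsup>a'\<^esup> + b\<^bsup>a'\<^esup>)\<^bsup>b'\<^esup>, b\<^bsup>b'\<^esup>)\<close> makes
  \<open>A \<times> Pentact(A)\<close> a reduced group with action.
\<close>

section \<open>Commutativity of reduced groups with action\<close>

context reduced_gwa
begin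

lemma act_inv_act:
  assumes "x \<in> carrier G" "y \<in> carrier G"
  shows "(x \<up> inv y) \<up> y = x"
  using assms act_act[of x "inv y" y] by (simp add: act_one)

lemma carrier_commute:
  assumes "x \<in> carrier G" "y \<in> carrier G"
  shows "x \<otimes> y = y \<otimes> x"
proof (cases "y = \<one>")
  case False
  then have "((x \<up> inv y) \<up> y) \<otimes> y = y \<otimes> ((x \<up> inv y) \<up> y)"
    using assms by (intro act_central) (auto simp: act_closed)
  then show ?thesis using assms by (simp add: act_inv_act)
qed (use assms in simp)

sublocale comm_group
  by (rule group_comm_groupI) (rule carrier_commute)

lemma eq_if_mult_inv_eq_one:
  assumes "x \<otimes> inv y = \<one>" "x \<in> carrier G" "y \<in> carrier G"
  shows "x = y"
  using assms inv_solve_right[of \<one> x y] by simp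

lemma one_act:
  assumes "h \<in> carrier G"
  shows "\<one> \<up> h = \<one>"
  using act_mult[of \<one> \<one> h] assms by (simp add: act_closed)

text \<open>Condition \<open>p6\<close> needs a nonzero exponent. Any nonzero \<open>y\<close>
  provides one for every \<open>x\<close>, by way of \<open>u = x \<up> inv y\<close>; only the
  trivial group has none.\<close>

lemma carrier_trivial_or_act_image:
  assumes "x \<in> carrier G"
  obtains "carrier G = {\<one>}"
  | u y where "u \<in> carrier G" "y \<in> carrier G" "y \<noteq> \<one>" "x = u \<up> y"
proof (cases "carrier G = {\<one>}")
  case False
  then obtain y where y: "y \<in> carrier G" "y \<noteq> \<one>" using one_closed by blast
  show ?thesis
    using that(2)[of "x \<up> inv y" y] y assms by (simp add: act_closed act_inv_act)
qed (use that in blast)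

end

section \<open>Simplified laws for a single pentaction\<close>

locale pentaction_of_reduced = reduced_gwa G + pentaction G b
  for G (structure) and b
begin

lemma closed [simp]:
  assumes "a \<in> carrier G"
  shows "rexp b a \<in> carrier G" "lexp b a \<in> carrier G" "bexp b a \<in> carrier G"
  using assms rexp_funcset lexp_funcset bexp_funcset by auto

lemma ldot_ident [simp]:
  assumes "a \<in> carrier G"
  shows "ldot b a = a"
  using assms
proof (cases rule: carrier_trivial_or_act_image)
  case 1
  then show ?thesis using assms ldot_funcset by auto
next
  case (2 u y)
  then show ?thesis by (simp add: p6)
qed

lemma rdot_ident [simp]:
  assumes "a \<in> carrier G"
  shows "rdot b a = a"
  using p11[OF assms] assms by simp

lemma bexp_one [simp]: "bexp b \<one> = \<one>"
  using p4[of \<one> \<one>] by (simp add: act_one)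

text \<open>Extends \<open>p10\<close> to the exponent zero, where \<open>bexp b\<close>
  vanishes.\<close>

lemma act_bexp:
  assumes "a \<in> carrier G" "a' \<in> carrier G"
  shows "a \<up> bexp b a' = a"
  using assms by (cases "a' = \<one>") (auto simp: p10 act_one)

lemma rexp_act:
  assumes "a \<in> carrier G" "a' \<in> carrier G"
  shows "rexp b (a \<up> a') = rexp b a \<up> a'"
  using p5[OF assms] assms by simp

lemma lexp_act:
  assumes "a \<in> carrier G" "a' \<in> carrier G"
  shows "lexp b (a \<up> a') = lexp b a \<up> a'"
  \<comment> \<open>Since \<open>p5'\<close> speaks of negated exponents, it is instantiated at
    \<open>inv a'\<close>.\<close>
  using p5'[of a "inv a'"] assms by simp

end

section \<open>The group of pentactions and its action operation\<close>

context reduced_gwa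
begin

abbreviation "pent b \<equiv> pentaction G b"

lemma pentaction_of_reducedI: "pent b \<Longrightarrow> pentaction_of_reduced G b"
  by (intro pentaction_of_reduced.intro reduced_gwa_axioms)

text \<open>Introduction rule for zero, sums, negatives and values of the action. With identity
  dots, conditions 3, 6 and 11 are trivial and 5 becomes compatibility with the action; condition 8
  follows from commutativity.\<close>

lemma pentactionI:
  assumes dots: "ldot b = (\<lambda>a \<in> carrier G. a)" "rdot b = (\<lambda>a \<in> carrier G. a)"
    and funcs: "rexp b \<in> carrier G \<rightarrow>\<^sub>E carrier G" "lexp b \<in> carrier G \<rightarrow>\<^sub>E carrier G"
      "bexp b \<in> carrier G \<rightarrow>\<^sub>E carrier G"
    and mult: "\<And>a a'. \<lbrakk>a \<in> carrier G; a' \<in> carrier G\<rbrakk> \<Longrightarrow> rexp b (a \<otimes> a') = rexp b a \<otimes> rexp b a'"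
      "\<And>a a'. \<lbrakk>a \<in> carrier G; a' \<in> carrier G\<rbrakk> \<Longrightarrow> lexp b (a \<otimes> a') = lexp b a \<otimes> lexp b a'"
      "\<And>a a'. \<lbrakk>a \<in> carrier G; a' \<in> carrier G\<rbrakk> \<Longrightarrow> bexp b (a \<otimes> a') = (bexp b a \<up> a') \<otimes> bexp b a'"
    and act: "\<And>a a'. \<lbrakk>a \<in> carrier G; a' \<in> carrier G\<rbrakk> \<Longrightarrow> rexp b (a \<up> a') = rexp b a \<up> a'"
      "\<And>a a'. \<lbrakk>a \<in> carrier G; a' \<in> carrier G\<rbrakk> \<Longrightarrow> lexp b (a \<up> a') = lexp b a \<up> a'"
      "\<And>a a'. \<lbrakk>a \<in> carrier G; a' \<in> carrier G\<rbrakk> \<Longrightarrow> bexp b (a \<up> a') = bexp b a"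
    and exp: "\<And>a a'. \<lbrakk>a \<in> carrier G; a' \<in> carrier G\<rbrakk> \<Longrightarrow> a \<up> rexp b a' = a \<up> a'"
      "\<And>a a'. \<lbrakk>a \<in> carrier G; a' \<in> carrier G\<rbrakk> \<Longrightarrow> a \<up> lexp b a' = a \<up> a'"
      "\<And>a a'. \<lbrakk>a \<in> carrier G; a' \<in> carrier G\<rbrakk> \<Longrightarrow> a \<up> bexp b a' = a"
    and inverse: "\<And>a. a \<in> carrier G \<Longrightarrow> lexp b (rexp b a) = a"
      "\<And>a. a \<in> carrier G \<Longrightarrow> rexp b (lexp b a) = a"
  shows "pent b"
proof -
  have [simp]: "rexp b a \<in> carrier G" "lexp b a \<in> carrier G" if "a \<in> carrier G" for a
    using that funcs by auto
  show ?thesis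
    by unfold_locales
       (use funcs in \<open>auto simp: dots mult act exp inverse act_closed intro: m_comm\<close>)
qed

text \<open>The component \<open>lexp\<close> need not be compared: it is the inverse of \<open>rexp\<close>.\<close>

lemma pentaction_eqI:
  assumes "pent b" "pent c"
    and rexp: "\<And>a. a \<in> carrier G \<Longrightarrow> rexp b a = rexp c a"
    and bexp: "\<And>a. a \<in> carrier G \<Longrightarrow> bexp b a = bexp c a"
  shows "b = c"
proof -
  interpret b: pentaction_of_reduced G b by (rule pentaction_of_reducedI) fact
  interpret c: pentaction_of_reduced G c by (rule pentaction_of_reducedI) fact
  have lexp: "lexp b a = lexp c a" if "a \<in> carrier G" for a
  proof -
    have "lexp b a = lexp b (rexp b (lexp c a))" using that by (simp add: rexp c.p12')
    then show ?thesis using that by (simp add: b.p12)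
  qed
  have "ldot b = ldot c"
    by (rule PiE_ext[OF b.ldot_funcset c.ldot_funcset]) simp
  moreover have "rdot b = rdot c"
    by (rule PiE_ext[OF b.rdot_funcset c.rdot_funcset]) simp
  moreover have "rexp b = rexp c"
    by (rule PiE_ext[OF b.rexp_funcset c.rexp_funcset]) (rule rexp)
  moreover have "lexp b = lexp c"
    by (rule PiE_ext[OF b.lexp_funcset c.lexp_funcset]) (rule lexp)
  moreover have "bexp b = bexp c"
    by (rule PiE_ext[OF b.bexp_funcset c.bexp_funcset]) (rule bexp)
  ultimately show ?thesis by simp
qed

lemma pent_zero_closed: "pent (pent_zero G)"
  by (rule pentactionI) (auto simp: pent_zero_def one_act act_one act_closed)

text \<open>Crossed homomorphisms into a commutative group are closed under pointwise sums, and a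
  sum of two exponents that act trivially acts trivially by \<open>act_act\<close>.\<close>

lemma pent_add_closed:
  assumes "pent b" "pent c"
  shows "pent (pent_add G b c)"
proof -
  interpret b: pentaction_of_reduced G b by (rule pentaction_of_reducedI) fact
  interpret c: pentaction_of_reduced G c by (rule pentaction_of_reducedI) fact
  show ?thesis
    by (rule pentactionI)
       (auto simp: pent_add_def act_closed act_mult b.p2 b.p2' c.p2 c.p2' b.p4 c.p4 b.rexp_act
          c.rexp_act b.lexp_act c.lexp_act b.p7 c.p7 b.p9 c.p9 b.p9' c.p9' b.act_bexp c.act_bexp
          act_act b.p12 b.p12' c.p12 c.p12' m_ac)
qed

text \<open>The inverse for \<open>pent_add\<close>. Because \<open>ldot b\<close> is the identity,
  the crossed homomorphism is negated pointwise, without a twist.\<close>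

definition pent_neg :: "'a quintuple \<Rightarrow> 'a quintuple" where
  "pent_neg b = \<lparr>
     ldot = (\<lambda>a \<in> carrier G. a),
     rdot = (\<lambda>a \<in> carrier G. a),
     rexp = lexp b,
     lexp = rexp b,
     bexp = (\<lambda>a \<in> carrier G. inv (bexp b a))\<rparr>"

lemma inv_act:
  assumes "x \<in> carrier G" "h \<in> carrier G"
  shows "inv x \<up> h = inv (x \<up> h)"
proof -
  have "(inv x \<up> h) \<otimes> (x \<up> h) = \<one>"
    using assms act_mult[of "inv x" x h] by (simp add: one_act)
  then show ?thesis using assms by (simp add: act_closed inv_equality)
qed

lemma pent_neg_closed:
  assumes "pent b"
  shows "pent (pent_neg b)"
proof -
  interpret b: pentaction_of_reduced G b by (rule pentaction_of_reducedI) fact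
  \<comment> \<open>Acting by \<open>bexp b a'\<close> undoes acting by its inverse, yet it fixes
    every element.\<close>
  have act_inv_bexp: "a \<up> inv (bexp b a') = a" if "a \<in> carrier G" "a' \<in> carrier G" for a a'
    using that act_inv_act[of a "bexp b a'"] b.act_bexp[of "a \<up> inv (bexp b a')" a']
    by (simp add: act_closed)
  show ?thesis
    by (rule pentactionI)
       (use b.rexp_funcset b.lexp_funcset in \<open>auto simp: pent_neg_def act_closed b.p2 b.p2' b.p4
          b.rexp_act b.lexp_act b.p7 b.p9 b.p9' act_inv_bexp b.p12 b.p12' inv_act inv_mult\<close>)
qed

text \<open>Composing \<open>bexp b\<close> with \<open>rexp c\<close> keeps it a crossed
  homomorphism, as \<open>rexp c\<close> is additive and commutes with the action; by
  \<open>p9\<close> its values still act trivially.\<close>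

lemma pent_act_closed:
  assumes "pent b" "pent c"
  shows "pent (pent_act G b c)"
proof -
  interpret b: pentaction_of_reduced G b by (rule pentaction_of_reducedI) fact
  interpret c: pentaction_of_reduced G c by (rule pentaction_of_reducedI) fact
  show ?thesis
    by (rule pentactionI)
       (auto simp: pent_act_def act_closed b.p2 b.p2' c.p2 b.p4 b.rexp_act c.rexp_act b.lexp_act
          b.p7 b.p9 c.p9 b.p9' b.act_bexp b.p12 b.p12')
qed

lemma Pentact_simps [simp]:
  "carrier (Pentact G) = {b. pent b}"
  "b \<otimes>\<^bsub>Pentact G\<^esub> c = pent_add G b c"
  "\<one>\<^bsub>Pentact G\<^esub> = pent_zero G"
  "b \<up>\<^bsub>Pentact G\<^esub> c = pent_act G b c"
  by (simp_all add: Pentact_def)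

lemma rexp_bexp_pent_zero [simp]:
  assumes "a \<in> carrier G"
  shows "rexp (pent_zero G) a = a" "bexp (pent_zero G) a = \<one>"
  using assms by (simp_all add: pent_zero_def)

lemma rexp_bexp_pent_add [simp]:
  assumes "pent b" "pent c" "a \<in> carrier G"
  shows "rexp (pent_add G b c) a = rexp c (rexp b a)"
    "bexp (pent_add G b c) a = bexp b a \<otimes> bexp c a"
proof -
  interpret b: pentaction_of_reduced G b by (rule pentaction_of_reducedI) fact
  interpret c: pentaction_of_reduced G c by (rule pentaction_of_reducedI) fact
  show "rexp (pent_add G b c) a = rexp c (rexp b a)"
    "bexp (pent_add G b c) a = bexp b a \<otimes> bexp c a"
    using assms by (simp_all add: pent_add_def)
qed

lemma rexp_bexp_pent_act [simp]:
  assumes "pent b" "pent c" "a \<in> carrier G"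
  shows "rexp (pent_act G b c) a = rexp b a"
    "bexp (pent_act G b c) a = rexp c (bexp b a)"
proof -
  interpret c: pentaction_of_reduced G c by (rule pentaction_of_reducedI) fact
  show "rexp (pent_act G b c) a = rexp b a"
    "bexp (pent_act G b c) a = rexp c (bexp b a)"
    using assms by (simp_all add: pent_act_def)
qed

lemma pent_closed [simp]:
  assumes "pent b" "a \<in> carrier G"
  shows "rexp b a \<in> carrier G" "bexp b a \<in> carrier G"
  using pentaction_of_reduced.closed[OF pentaction_of_reducedI] assms by auto

lemma pent_rexp_mult:
  assumes "pent b" "a \<in> carrier G" "a' \<in> carrier G"
  shows "rexp b (a \<otimes> a') = rexp b a \<otimes> rexp b a'"
  using assms by (rule pentaction.p2)

lemma pent_rexp_one [simp]:
  assumes "pent b"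
  shows "rexp b \<one> = \<one>"
  using pent_rexp_mult[OF assms, of \<one> \<one>] assms by simp

lemma pent_add_zero [simp]:
  assumes "pent b"
  shows "pent_add G b (pent_zero G) = b"
  using assms by (intro pentaction_eqI) (simp_all add: pent_add_closed pent_zero_closed)

lemma pent_act_zero [simp]:
  assumes "pent b"
  shows "pent_act G b (pent_zero G) = b" "pent_act G (pent_zero G) b = pent_zero G"
  using assms by (auto intro!: pentaction_eqI simp: pent_act_closed pent_zero_closed)

lemma group_Pentact: "group (Pentact G)"
proof (rule groupI)
  fix b assume "b \<in> carrier (Pentact G)"
  then interpret b: pentaction_of_reduced G b by (simp add: pentaction_of_reducedI)
  have b: "pent b" by (rule b.pentaction_axioms)
  have rexp_neg: "rexp (pent_neg b) a = lexp b a" for a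
    by (simp add: pent_neg_def)
  have bexp_neg: "bexp (pent_neg b) a = inv (bexp b a)" if "a \<in> carrier G" for a
    using that by (simp add: pent_neg_def)
  have "pent_add G (pent_neg b) b = pent_zero G"
    by (rule pentaction_eqI)
       (use b rexp_neg bexp_neg in \<open>simp_all add: pent_neg_closed pent_add_closed pent_zero_closed b.p12'\<close>)
  then show "\<exists>c \<in> carrier (Pentact G). c \<otimes>\<^bsub>Pentact G\<^esub> b = \<one>\<^bsub>Pentact G\<^esub>"
    using pent_neg_closed[OF b] by auto
qed (auto simp: pent_add_closed pent_zero_closed m_assoc intro!: pentaction_eqI)

end

section \<open>The vanishing weak stabilizer and the semidirect product\<close>

locale reduced_gwa_wStab_zero = reduced_gwa G for G (structure) +
  assumes wStab_zero: "wStab G = {\<one>}"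
begin

lemma bexp_bexp [simp]:
  assumes "pent b" "pent c" "a \<in> carrier G"
  shows "bexp b (bexp c a) = \<one>"
proof -
  have "bexp b (bexp c a) \<in> wStab G"
    using assms unfolding wStab_def Pentact_simps by blast
  then show ?thesis by (simp add: wStab_zero)
qed

lemma bexp_rexp [simp]:
  assumes "pent b" "pent c" "a \<in> carrier G"
  shows "bexp b (rexp c a) = bexp b a"
proof -
  have "bexp b (rexp c a) \<otimes> inv (bexp b a) \<in> wStab G"
    using assms unfolding wStab_def Pentact_simps by blast
  then show ?thesis using assms by (auto simp: wStab_zero dest: eq_if_mult_inv_eq_one)
qed

lemma rexp_commute:
  assumes "pent b" "pent c" "a \<in> carrier G"
  shows "rexp c (rexp b a) = rexp b (rexp c a)"
proof -
  have "rexp (pent_add G b c) a \<otimes> inv (rexp (pent_add G c b) a) \<in> wStab G"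
    using assms unfolding wStab_def Pentact_simps by blast
  then show ?thesis using assms by (auto simp: wStab_zero dest: eq_if_mult_inv_eq_one)
qed

text \<open>Centrality comes from commutativity of the whole group: the automorphisms commute by
  \<open>rexp_commute\<close>, and the crossed homomorphisms add in a commutative group. The
  exponent law holds because an exponent acts only through its \<open>rexp\<close>, which
  \<open>pent_act\<close> leaves unchanged.\<close>

lemma reduced_gwa_Pentact: "reduced_gwa (Pentact G)"
  by (intro reduced_gwa.intro group_with_action.intro group_Pentact group_with_action_axioms.intro
        reduced_gwa_axioms.intro)
     (auto simp: pent_act_closed pent_add_closed pent_zero_closed pent_rexp_mult rexp_commute m_comm
        intro!: pentaction_eqI)

text \<open>The pair \<open>(a, b)\<close> stands for \<open>i(a) + j(b)\<close>. Addition is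
  componentwise because \<open>ldot b\<close> is the identity; the action arises by expanding
  \<open>(a + b)^(a' + b')\<close>, where \<open>j(b)^(a')\<close> is
  \<open>bexp b a' + j(b)\<close>.\<close>

definition semidirect :: "('a \<times> 'a quintuple) gact" where
  "semidirect = \<lparr>
     carrier = carrier G \<times> carrier (Pentact G),
     mult = (\<lambda>(a, b) (a', b'). (a \<otimes> a', b \<otimes>\<^bsub>Pentact G\<^esub> b')),
     one = (\<one>, \<one>\<^bsub>Pentact G\<^esub>),
     actn = (\<lambda>(a, b) (a', b'). (rexp b' ((a \<up> a') \<otimes> bexp b a'), b \<up>\<^bsub>Pentact G\<^esub> b'))\<rparr>"

lemma semidirect_simps [simp]:
  "carrier semidirect = carrier G \<times> carrier (Pentact G)"
  "(a, b) \<otimes>\<^bsub>semidirect\<^esub> (a', b') = (a \<otimes> a', b \<otimes>\<^bsub>Pentact G\<^esub> b')"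
  "\<one>\<^bsub>semidirect\<^esub> = (\<one>, \<one>\<^bsub>Pentact G\<^esub>)"
  "(a, b) \<up>\<^bsub>semidirect\<^esub> (a', b') = (rexp b' ((a \<up> a') \<otimes> bexp b a'), b \<up>\<^bsub>Pentact G\<^esub> b')"
  by (simp_all add: semidirect_def)

lemma reduced_gwa_semidirect: "reduced_gwa semidirect"
proof -
  interpret P: reduced_gwa "Pentact G" by (rule reduced_gwa_Pentact)
  have "group semidirect"
  proof (rule groupI)
    fix x assume "x \<in> carrier semidirect"
    then obtain a b where x: "x = (a, b)" "a \<in> carrier G" "b \<in> carrier (Pentact G)" by auto
    then have "(inv a, inv\<^bsub>Pentact G\<^esub> b) \<in> carrier semidirect"
      "(inv a, inv\<^bsub>Pentact G\<^esub> b) \<otimes>\<^bsub>semidirect\<^esub> x = \<one>\<^bsub>semidirect\<^esub>"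
      using P.inv_closed[of b] P.l_inv[of b] by auto
    then show "\<exists>y \<in> carrier semidirect. y \<otimes>\<^bsub>semidirect\<^esub> x = \<one>\<^bsub>semidirect\<^esub>" by blast
  qed (use P.m_closed P.one_closed P.m_assoc P.l_one in \<open>auto simp: m_assoc\<close>)
  moreover have "group_with_action_axioms semidirect"
  proof (rule group_with_action_axioms.intro, goal_cases)
    case (1 g h)
    then show ?case by (auto simp: act_closed pent_act_closed)
  next
    case (2 g g' h)
    then show ?case
      using P.act_mult by (auto simp: act_closed act_mult pent_rexp_mult m_ac)
  next
    case (3 g h h')
    obtain a b a' b' a'' b'' where eqs: "g = (a, b)" "h = (a', b')" "h' = (a'', b'')"
      by (metis surj_pair)
    with 3 have c: "a \<in> carrier G" "a' \<in> carrier G" "a'' \<in> carrier G" "pent b" "pent b'" "pent b''"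
      by auto
    from c(5) interpret b': pentaction_of_reduced G b' by (rule pentaction_of_reducedI)
    \<comment> \<open>The first coordinates agree before \<open>rexp b''\<close> is applied:
      \<open>p4\<close> splits the crossed homomorphism, \<open>rexp_act\<close> moves
      \<open>a''\<close> outside, and the last term is the \<open>bexp\<close> of
      \<open>pent_act G b b'\<close> at \<open>a''\<close>.\<close>
    have "rexp b' ((a \<up> (a' \<otimes> a'')) \<otimes> bexp b (a' \<otimes> a''))
        = (rexp b' ((a \<up> a') \<otimes> bexp b a') \<up> a'') \<otimes> rexp b' (bexp b a'')"
      using c pentaction.p4[OF c(4), of a' a'']
      by (simp add: act_act act_closed act_mult pent_rexp_mult b'.rexp_act m_assoc)
    then show ?case
      using c P.act_act[of b b' b''] by (simp add: eqs act_closed)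
  next
    case (4 g)
    then show ?case
      using P.act_one by (auto simp: act_one pentaction_of_reduced.bexp_one pentaction_of_reducedI)
  qed
  moreover have "reduced_gwa_axioms semidirect"
  proof (rule reduced_gwa_axioms.intro, goal_cases)
    case (1 x y z)
    have "u \<otimes>\<^bsub>semidirect\<^esub> z = z \<otimes>\<^bsub>semidirect\<^esub> u" if "u \<in> carrier semidirect" for u
      using that 1(3) P.m_comm by (auto simp: m_comm)
    moreover have "x \<up>\<^bsub>semidirect\<^esub> y \<in> carrier semidirect"
      using 1 by (auto simp: act_closed pent_act_closed)
    ultimately show ?case by blast
  next
    case (2 x y z)
    obtain a b a' b' a'' b'' where eqs: "x = (a, b)" "y = (a', b')" "z = (a'', b'')"
      by (metis surj_pair)
    with 2 have c: "a \<in> carrier G" "a' \<in> carrier G" "a'' \<in> carrier G" "pent b" "pent b'" "pent b''"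
      by auto
    from c(4) interpret b: pentaction_of_reduced G b by (rule pentaction_of_reducedI)
    from c(5) interpret b': pentaction_of_reduced G b' by (rule pentaction_of_reducedI)
    from c(6) interpret b'': pentaction_of_reduced G b'' by (rule pentaction_of_reducedI)
    \<comment> \<open>In the exponent, \<open>p9\<close> strips \<open>rexp b''\<close>, the term
      \<open>bexp b' a''\<close> acts trivially, and \<open>act_exp\<close> drops
      \<open>a''\<close>.\<close>
    have "a \<up> rexp b'' ((a' \<up> a'') \<otimes> bexp b' a'') = a \<up> a'"
      using c by (simp add: b''.p9 act_closed act_act b'.act_bexp act_exp)
    \<comment> \<open>The weak stabilizer enters here: \<open>bexp_rexp\<close> strips
      \<open>rexp b''\<close>, and after expansion by \<open>p4\<close> the second term vanishes by
      \<open>bexp_bexp\<close>. In the first term \<open>act_bexp\<close> removes the outer exponent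
      and \<open>p7\<close> drops \<open>a''\<close>.\<close>
    moreover have "bexp b (rexp b'' ((a' \<up> a'') \<otimes> bexp b' a'')) = bexp b a'"
      using c by (simp add: act_closed b.p4 b.p7 b'.act_bexp)
    ultimately show ?case
      using c P.act_exp[of b b' b''] by (simp add: eqs act_closed)
  qed
  ultimately show ?thesis
    by (intro reduced_gwa.intro group_with_action.intro)
qed

section \<open>The split extension and its induced action\<close>

lemma split_extension_semidirect:
  "split_extension G semidirect (Pentact G) (\<lambda>a. (a, \<one>\<^bsub>Pentact G\<^esub>)) snd (\<lambda>b. (\<one>, b))"
proof -
  have "(\<lambda>a. (a, \<one>\<^bsub>Pentact G\<^esub>)) \<in> gwa_hom G semidirect"
    by (auto simp: gwa_hom_def hom_def pent_zero_closed act_closed)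
  moreover have "(\<lambda>b. (\<one>, b)) \<in> gwa_hom (Pentact G) semidirect"
    by (auto simp: gwa_hom_def hom_def act_one
        pentaction_of_reduced.bexp_one pentaction_of_reducedI)
  moreover have "snd \<in> gwa_hom semidirect (Pentact G)"
    by (auto simp: gwa_hom_def hom_def)
  moreover have "(\<lambda>a. (a, \<one>\<^bsub>Pentact G\<^esub>)) ` carrier G = kernel semidirect (Pentact G) snd"
    by (auto simp: kernel_def pent_zero_closed)
  moreover have "snd ` carrier semidirect = carrier (Pentact G)"
    using one_closed by (auto simp: image_iff)
  ultimately show ?thesis
    unfolding split_extension_def
    by (intro conjI reduced_gwa_axioms reduced_gwa_semidirect reduced_gwa_Pentact)
       (assumption | simp add: inj_on_def)+
qed

lemma induced_action_semidirect:
  "induced_action G semidirect (Pentact G) (\<lambda>a. (a, \<one>\<^bsub>Pentact G\<^esub>)) (\<lambda>b. (\<one>, b)) ldot bexp rexp"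
  unfolding induced_action_def
proof (intro ballI)
  interpret P: reduced_gwa "Pentact G" by (rule reduced_gwa_Pentact)
  interpret E: reduced_gwa semidirect by (rule reduced_gwa_semidirect)
  fix b a assume b: "b \<in> carrier (Pentact G)" and a: "a \<in> carrier G"
  then interpret b: pentaction_of_reduced G b by (simp add: pentaction_of_reducedI)
  have inv: "inv\<^bsub>semidirect\<^esub> (\<one>, b) = (\<one>, inv\<^bsub>Pentact G\<^esub> b)"
    using b P.l_inv[OF b] P.inv_closed[OF b] by (intro E.inv_equality) auto
  \<comment> \<open>These evaluate the second coordinates \<open>b + 0 - b\<close>,
    \<open>b^0 - b\<close> and \<open>0^b\<close> of the three right-hand sides, all of them
    zero.\<close>
  have "b \<up>\<^bsub>Pentact G\<^esub> \<one>\<^bsub>Pentact G\<^esub> = b" "\<one>\<^bsub>Pentact G\<^esub> \<up>\<^bsub>Pentact G\<^esub> b = \<one>\<^bsub>Pentact G\<^esub>"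
    "b \<otimes>\<^bsub>Pentact G\<^esub> \<one>\<^bsub>Pentact G\<^esub> = b" "b \<otimes>\<^bsub>Pentact G\<^esub> inv\<^bsub>Pentact G\<^esub> b = \<one>\<^bsub>Pentact G\<^esub>"
    using b by (auto simp only: P.act_one P.one_act P.r_one P.r_inv)
  then show "ldot b a \<in> carrier G \<and> bexp b a \<in> carrier G \<and> rexp b a \<in> carrier G \<and>
      (ldot b a, \<one>\<^bsub>Pentact G\<^esub>)
        = (\<one>, b) \<otimes>\<^bsub>semidirect\<^esub> (a, \<one>\<^bsub>Pentact G\<^esub>) \<otimes>\<^bsub>semidirect\<^esub> inv\<^bsub>semidirect\<^esub> (\<one>, b) \<and>
      (bexp b a, \<one>\<^bsub>Pentact G\<^esub>)
        = ((\<one>, b) \<up>\<^bsub>semidirect\<^esub> (a, \<one>\<^bsub>Pentact G\<^esub>)) \<otimes>\<^bsub>semidirect\<^esub> inv\<^bsub>semidirect\<^esub> (\<one>, b) \<and>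
      (rexp b a, \<one>\<^bsub>Pentact G\<^esub>) = (a, \<one>\<^bsub>Pentact G\<^esub>) \<up>\<^bsub>semidirect\<^esub> (\<one>, b)"
    using a by (simp add: inv one_act act_one)
qed

end

theorem theorem4p1:
  fixes A :: "('a, 'm) gact_scheme" (structure)
  assumes "reduced_gwa A"
    and "perfect A"
    and "wStab A = {\<one>}"
  shows "derived_action A (Pentact A) (\<lambda>b a. ldot b a) (\<lambda>b a. bexp b a) (\<lambda>b a. rexp b a)"
proof -
  interpret reduced_gwa_wStab_zero A
    using assms by (intro reduced_gwa_wStab_zero.intro reduced_gwa_wStab_zero_axioms.intro)
  show ?thesis
    by (rule derived_actionI[OF split_extension_semidirect induced_action_semidirect])
qed

end
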